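(* Let $A_n = A_n(h,T)$ be an apex tree. Then its maximum frustration index is $l_{\max}(A_n) = \left\lfloor \frac{n}{2} \right\rfloor$.
   Context: All graphs are finite, simple and undirected. A signed graph $\Sigma=(G,\sigma)$ is a graph $G$ with a signature $\sigma:E(G)\to\{+1,-1\}$. The sign of a cycle is the product of the signs of its edges; $\Sigma$ is balanced if all its cycles are positive. The frustration index $l(\Sigma)$ is the minimum number of edges whose deletion makes $\Sigma$ balanced. $l_{\max}(G)=\max_\sigma l(G,\sigma)$ over all signatures $\sigma$ of $G$. Apex tree: $A_n(h,T)$ denotes a graph with a vertex $h$ of degree $n$ such that deleting $h$ leaves the tree $T$. Standing assumptions: all leaves of $T$ are neighbours of $h$; the graph is $2$-connected (the trivial case $A_1=K_2$ is allowed); and every vertex of degree $2$ in the graph is contained in a triangle. *)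

theory Defs
  imports Main
begin

text \<open>
  A simple graph is given by a vertex set \<open>V\<close> and a set \<open>E\<close> of two-element vertex sets.
  Deletion of edges and balance depend only on \<open>E\<close>, so the corresponding notions take
  \<open>E\<close> alone.
\<close>

definition simple_graph :: "'a set \<Rightarrow> 'a set set \<Rightarrow> bool" where
  "simple_graph V E \<longleftrightarrow> finite V \<and> (\<forall>e\<in>E. e \<subseteq> V \<and> card e = 2)"

definition degree :: "'a set set \<Rightarrow> 'a \<Rightarrow> nat" where
  "degree E v = card {e \<in> E. v \<in> e}"

definition connected_graph :: "'a set \<Rightarrow> 'a set set \<Rightarrow> bool" where
  "connected_graph V E \<longleftrightarrow>
     V \<noteq> {} \<and> (\<forall>u\<in>V. \<forall>v\<in>V. (u, v) \<in> {(x, y). {x, y} \<in> E}\<^sup>*)"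

definition remove_vertex :: "'a set set \<Rightarrow> 'a \<Rightarrow> 'a set set" where
  "remove_vertex E v = {e \<in> E. v \<notin> e}"

definition two_connected :: "'a set \<Rightarrow> 'a set set \<Rightarrow> bool" where
  "two_connected V E \<longleftrightarrow>
     card V \<ge> 3 \<and> connected_graph V E \<and>
     (\<forall>v\<in>V. connected_graph (V - {v}) (remove_vertex E v))"

text \<open>
  A cycle is listed by its distinct vertices in cyclic order. Since there are at least three
  of them, the edges between cyclically consecutive vertices are pairwise distinct, so a
  product over the set \<open>cycle_edges c\<close> counts every edge of the cycle exactly once.
\<close>

definition cycle_edges :: "'a list \<Rightarrow> 'a set set" where
  "cycle_edges c = {{c ! i, c ! (Suc i mod length c)} | i. i < length c}"

definition is_cycle :: "'a set set \<Rightarrow> 'a list \<Rightarrow> bool" where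
  "is_cycle E c \<longleftrightarrow> length c \<ge> 3 \<and> distinct c \<and> cycle_edges c \<subseteq> E"

definition is_tree :: "'a set \<Rightarrow> 'a set set \<Rightarrow> bool" where
  "is_tree V E \<longleftrightarrow> simple_graph V E \<and> connected_graph V E \<and> (\<nexists>c. is_cycle E c)"

definition signature :: "'a set set \<Rightarrow> ('a set \<Rightarrow> int) \<Rightarrow> bool" where
  "signature E \<sigma> \<longleftrightarrow> (\<forall>e\<in>E. \<sigma> e \<in> {1, -1})"

definition cycle_sign :: "('a set \<Rightarrow> int) \<Rightarrow> 'a list \<Rightarrow> int" where
  "cycle_sign \<sigma> c = (\<Prod>e\<in>cycle_edges c. \<sigma> e)"

definition balanced :: "'a set set \<Rightarrow> ('a set \<Rightarrow> int) \<Rightarrow> bool" where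
  "balanced E \<sigma> \<longleftrightarrow> (\<forall>c. is_cycle E c \<longrightarrow> cycle_sign \<sigma> c = 1)"

text \<open>
  For finite \<open>E\<close> both extrema below range over finite nonempty sets of numbers: deleting all
  of \<open>E\<close> always yields a balanced graph, and no frustration index exceeds \<open>card E\<close>.
\<close>

definition frustration_index :: "'a set set \<Rightarrow> ('a set \<Rightarrow> int) \<Rightarrow> nat" where
  "frustration_index E \<sigma> = Min {card D | D. D \<subseteq> E \<and> balanced (E - D) \<sigma>}"

definition max_frustration_index :: "'a set set \<Rightarrow> nat" where
  "max_frustration_index E = Max {frustration_index E \<sigma> | \<sigma>. signature E \<sigma>}"

text \<open>
  The tree \<open>T\<close> of an apex tree is not a separate parameter, being determined as the graph
  left after deleting \<open>h\<close>. The alternative to \<open>two_connected\<close> admits \<open>K\<^sub>2\<close>, which has too few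
  vertices to be 2-connected.
\<close>

definition apex_tree :: "'a set \<Rightarrow> 'a set set \<Rightarrow> 'a \<Rightarrow> nat \<Rightarrow> bool" where
  "apex_tree V E h n \<longleftrightarrow>
     simple_graph V E \<and> h \<in> V \<and> degree E h = n \<and>
     is_tree (V - {h}) (remove_vertex E h) \<and>
     (\<forall>v\<in>V - {h}. degree (remove_vertex E h) v = 1 \<longrightarrow> {h, v} \<in> E) \<and>
     (two_connected V E \<or> card V = 2 \<and> E = {V}) \<and>
     (\<forall>v\<in>V. degree E v = 2 \<longrightarrow> (\<exists>u w. {v, u} \<in> E \<and> {u, w} \<in> E \<and> {w, v} \<in> E))"

end

theory Submission
  imports Defs
begin

text \<open>
  A signed graph is balanced iff its signs come from a vertex potential
  \<open>p : V \<rightarrow> {1, -1}\<close> via \<open>\<sigma>(uv) = p(u) p(v)\<close> (Harary). The tree \<open>T\<close> is trivially balanced, hence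
  has such a potential; it splits the \<open>n\<close> edges at \<open>h\<close> into those agreeing with it and those
  that do not, and deleting the smaller class leaves a balanced graph. So \<open>l \<le> n div 2\<close>.

  For the lower bound let \<open>T\<close> be positive. Working upwards from the leaves, the neighbours of
  \<open>h\<close> can be paired up, all but at most one, by edge-disjoint paths of \<open>T\<close>. Give the two edges
  from \<open>h\<close> to each pair opposite signs: this yields \<open>n div 2\<close> edge-disjoint negative cycles. In
  terms of potentials: at least \<open>n div 2\<close> edges disagree with any given potential.
\<close>

section \<open>Balance and potentials\<close>

text \<open>A switching function turning every sign of \<open>E\<close> into +1. It takes values in
  {1, -1} at all elements of the type, so no vertex set has to be carried along.\<close>

definition potential :: "'a set set \<Rightarrow> ('a set \<Rightarrow> int) \<Rightarrow> ('a \<Rightarrow> int) \<Rightarrow> bool" where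
  "potential E \<sigma> p \<longleftrightarrow>
     (\<forall>v. p v \<in> {1, -1}) \<and> (\<forall>u v. {u, v} \<in> E \<longrightarrow> \<sigma> {u, v} = p u * p v)"

lemma bij_betw_Suc_mod: "bij_betw (\<lambda>i. Suc i mod n) {..<n} {..<n}"
proof (cases "n = 0")
  case False
  have "inj_on (\<lambda>i. Suc i mod n) {..<n}"
    by (auto simp: inj_on_def mod_Suc split: if_splits)
  moreover have "(\<lambda>i. Suc i mod n) ` {..<n} \<subseteq> {..<n}"
    using False by auto
  ultimately show ?thesis
    by (simp add: bij_betw_def endo_inj_surj)
qed (simp add: bij_betw_def)

text \<open>Distinct positions giving the same edge would be cyclic successors of each other, which
  happens only in length 2. Hence a product over the set \<open>cycle_edges c\<close> may be taken
  over positions.\<close>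

lemma inj_on_cycle_edge:
  assumes "distinct c" "length c \<ge> 3"
  shows "inj_on (\<lambda>i. {c ! i, c ! (Suc i mod length c)}) {..<length c}"
proof (rule inj_onI)
  fix i j
  let ?n = "length c"
  assume i: "i \<in> {..<?n}" and j: "j \<in> {..<?n}"
    and eq: "{c ! i, c ! (Suc i mod ?n)} = {c ! j, c ! (Suc j mod ?n)}"
  have lt: "Suc i mod ?n < ?n" "Suc j mod ?n < ?n" "i < ?n" "j < ?n"
    using i j by (auto intro: mod_less_divisor)
  from eq consider "c ! i = c ! j" | "c ! i = c ! (Suc j mod ?n)" "c ! (Suc i mod ?n) = c ! j"
    by (auto simp: doubleton_eq_iff)
  then show "i = j"
  proof cases
    case 1
    then show ?thesis using assms(1) lt by (simp add: nth_eq_iff_index_eq)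
  next
    case 2
    then have "i = Suc j mod ?n" "Suc i mod ?n = j"
      using assms(1) lt by (simp_all add: nth_eq_iff_index_eq)
    then show ?thesis using assms(2) lt by (auto simp: mod_Suc split: if_splits)
  qed
qed

text \<open>Each vertex of the cycle is once the first and once the second end of an edge, so its
  potential enters squared and cancels.\<close>

lemma cycle_sign_switch:
  assumes "distinct c" "length c \<ge> 3" and p: "\<And>v. p v \<in> {1, -1}"
  shows "cycle_sign \<sigma> c = (\<Prod>i<length c.
    \<sigma> {c ! i, c ! (Suc i mod length c)} * (p (c ! i) * p (c ! (Suc i mod length c))))"
proof -
  let ?n = "length c"
  have "cycle_edges c = (\<lambda>i. {c ! i, c ! (Suc i mod ?n)}) ` {..<?n}"
    by (auto simp: cycle_edges_def)
  then have "cycle_sign \<sigma> c = (\<Prod>i<?n. \<sigma> {c ! i, c ! (Suc i mod ?n)})"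
    using inj_on_cycle_edge[OF assms(1,2)] by (simp add: cycle_sign_def prod.reindex)
  moreover have "(\<Prod>i<?n. p (c ! (Suc i mod ?n))) = (\<Prod>i<?n. p (c ! i))"
    using prod.reindex_bij_betw[OF bij_betw_Suc_mod, of "\<lambda>i. p (c ! i)" ?n] .
  moreover have "(\<Prod>i<?n. p (c ! i)) * (\<Prod>i<?n. p (c ! i)) = 1"
  proof -
    have "p v * p v = 1" for v
      using p[of v] by auto
    then show ?thesis
      by (simp add: prod.distrib[symmetric])
  qed
  ultimately show ?thesis
    by (simp add: prod.distrib)
qed

lemma potential_imp_balanced:
  assumes "potential E \<sigma> p"
  shows "balanced E \<sigma>"
  unfolding balanced_def
proof (intro allI impI)
  fix c
  assume c: "is_cycle E c"
  let ?n = "length c"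
  have p: "p v \<in> {1, -1}" for v
    using assms by (simp add: potential_def)
  have "\<sigma> {c ! i, c ! (Suc i mod ?n)} * (p (c ! i) * p (c ! (Suc i mod ?n))) = 1"
    if "i < ?n" for i
  proof -
    have "{c ! i, c ! (Suc i mod ?n)} \<in> E"
      using c that by (auto simp: is_cycle_def cycle_edges_def)
    then have "\<sigma> {c ! i, c ! (Suc i mod ?n)} = p (c ! i) * p (c ! (Suc i mod ?n))"
      using assms by (simp add: potential_def)
    then show ?thesis
      using p[of "c ! i"] p[of "c ! (Suc i mod ?n)"] by auto
  qed
  then show "cycle_sign \<sigma> c = 1"
    using c cycle_sign_switch[of c p \<sigma>] p by (simp add: is_cycle_def)
qed

text \<open>Extend the path step by step; when a step returns to a vertex already listed, cut the
  path back to that vertex.\<close>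

lemma rtrancl_imp_simple_path:
  assumes "(u, v) \<in> {(x, y). {x, y} \<in> E}\<^sup>*"
  shows "\<exists>xs. xs \<noteq> [] \<and> distinct xs \<and> hd xs = u \<and> last xs = v \<and>
    successively (\<lambda>x y. {x, y} \<in> E) xs"
  using assms
proof (induction rule: rtrancl_induct)
  case base
  show ?case by (rule exI[of _ "[u]"]) simp
next
  case (step y z)
  then obtain xs where xs: "xs \<noteq> []" "distinct xs" "hd xs = u" "last xs = y"
    "successively (\<lambda>x y. {x, y} \<in> E) xs"
    by blast
  show ?case
  proof (cases "z \<in> set xs")
    case True
    then obtain ys zs where "xs = (ys @ [z]) @ zs"
      by (metis split_list append.assoc append_Cons append_Nil)
    moreover from this have "successively (\<lambda>x y. {x, y} \<in> E) (ys @ [z])"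
      using xs(5) by (metis successively_append_iff)
    ultimately show ?thesis
      using xs by (intro exI[of _ "ys @ [z]"]) (cases ys; simp)
  next
    case False
    with xs step.hyps(2) show ?thesis
      by (intro exI[of _ "xs @ [z]"]) (auto simp: successively_append_iff)
  qed
qed

lemma potential_insertI:
  assumes "potential E \<sigma> p" "\<sigma> {u, v} = p u * p v"
  shows "potential (insert {u, v} E) \<sigma> p"
  unfolding potential_def
proof (intro conjI allI impI)
  fix x y
  assume "{x, y} \<in> insert {u, v} E"
  then consider "{x, y} \<in> E" | "x = u" "y = v" | "x = v" "y = u"
    by (auto simp: doubleton_eq_iff)
  then show "\<sigma> {x, y} = p x * p y"
    by cases (use assms in \<open>simp_all add: potential_def insert_commute mult.commute\<close>)
qed (use assms in \<open>simp add: potential_def\<close>)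

lemma balanced_mono: "balanced E \<sigma> \<Longrightarrow> F \<subseteq> E \<Longrightarrow> balanced F \<sigma>"
  by (auto simp: balanced_def is_cycle_def)

text \<open>The new edge closes a simple path of \<open>E\<close> to a cycle. After switching by
  \<open>p\<close> all factors along the path are 1, so the sign of the cycle is that of the
  switched chord, and balance makes it positive.\<close>

lemma balanced_chord_sign:
  assumes bal: "balanced (insert {u, v} E) \<sigma>" and p: "potential E \<sigma> p"
    and "{u, v} \<notin> E" "u \<noteq> v" and path: "(u, v) \<in> {(x, y). {x, y} \<in> E}\<^sup>*"
    and sig: "\<sigma> {u, v} \<in> {1, -1}"
  shows "\<sigma> {u, v} = p u * p v"
proof -
  obtain c where c: "c \<noteq> []" "distinct c" "hd c = u" "last c = v"
    "successively (\<lambda>x y. {x, y} \<in> E) c"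
    using rtrancl_imp_simple_path[OF path] by blast
  let ?n = "length c"
  let ?f = "\<lambda>i. \<sigma> {c ! i, c ! (Suc i mod ?n)} * (p (c ! i) * p (c ! (Suc i mod ?n)))"
  have pv: "p x \<in> {1, -1}" for x
    using p by (simp add: potential_def)
  have adj: "{c ! i, c ! Suc i} \<in> E" if "Suc i < ?n" for i
    using c(5) that by (simp add: successively_conv_nth)
  have ends: "c ! 0 = u" "c ! (?n - 1) = v"
    using c by (simp_all add: hd_conv_nth last_conv_nth)
  \<comment> \<open>Length 1 would mean \<open>u = v\<close>, and length 2 would put the chord into
    \<open>E\<close>.\<close>
  have "?n \<noteq> 0" "?n \<noteq> 1" "?n \<noteq> 2"
    using c(1) ends \<open>u \<noteq> v\<close> adj[of 0] \<open>{u, v} \<notin> E\<close> by auto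
  then have len: "?n \<ge> 3" by linarith
  \<comment> \<open>The last position: its successor wraps around to 0, so its edge is the
    chord.\<close>
  define m where "m = ?n - 1"
  have n: "?n = Suc m" using len by (simp add: m_def)
  have "{c ! i, c ! (Suc i mod ?n)} \<in> insert {u, v} E" if "i < ?n" for i
  proof (cases "i = m")
    case True
    then show ?thesis using ends n by (auto simp: insert_commute)
  next
    case False
    then show ?thesis using adj[of i] that n by simp
  qed
  then have "is_cycle (insert {u, v} E) c"
    using c(2) len by (auto simp: is_cycle_def cycle_edges_def)
  then have "1 = (\<Prod>i<?n. ?f i)"
    using bal cycle_sign_switch[of c p \<sigma>] c(2) len pv by (auto simp: balanced_def)
  also have "\<dots> = ?f m * (\<Prod>i<m. ?f i)"
    by (simp add: n mult.commute)
  also have "(\<Prod>i<m. ?f i) = 1"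
  proof (rule prod.neutral, rule ballI)
    fix i assume "i \<in> {..<m}"
    then have "\<sigma> {c ! i, c ! Suc i} = p (c ! i) * p (c ! Suc i)" "Suc i mod ?n = Suc i"
      using p adj[of i] n by (auto simp: potential_def)
    then show "?f i = 1"
      using pv[of "c ! i"] pv[of "c ! Suc i"] by auto
  qed
  also have "?f m = \<sigma> {u, v} * (p u * p v)"
    using ends n by (simp add: insert_commute mult.commute)
  finally show ?thesis
    using pv[of u] pv[of v] sig by auto
qed

text \<open>Add the edges one at a time. If a new edge disagrees with \<open>p\<close>, its ends
  cannot already be connected, and negating \<open>p\<close> on one component repairs this edge
  while preserving all products along old edges.\<close>

lemma balanced_imp_potential:
  assumes "finite E" "\<forall>e\<in>E. card e = 2" "signature E \<sigma>" "balanced E \<sigma>"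
  shows "\<exists>p. potential E \<sigma> p"
  using assms
proof (induction E rule: finite_induct)
  case empty
  show ?case by (rule exI[of _ "\<lambda>_. 1"]) (simp add: potential_def)
next
  case (insert e E)
  have "balanced E \<sigma>"
    using balanced_mono[OF insert.prems(3)] by auto
  with insert obtain p where p: "potential E \<sigma> p"
    by (auto simp: signature_def)
  then have pv: "p x \<in> {1, -1}" for x
    by (simp add: potential_def)
  have sig: "\<sigma> e \<in> {1, -1}"
    using insert.prems by (simp add: signature_def)
  obtain u v where e: "e = {u, v}" "u \<noteq> v"
    using insert.prems(1) by (auto simp: card_2_iff)
  \<comment> \<open>The component of \<open>u\<close> before \<open>e\<close> is added.\<close>
  define C where "C = {x. (u, x) \<in> {(x, y). {x, y} \<in> E}\<^sup>*}"
  have C: "x \<in> C \<longleftrightarrow> y \<in> C" if "{x, y} \<in> E" for x y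
  proof -
    have "(x, y) \<in> {(x, y). {x, y} \<in> E}" "(y, x) \<in> {(x, y). {x, y} \<in> E}"
      using that by (simp_all add: insert_commute)
    then show ?thesis
      unfolding C_def by (blast intro: rtrancl_into_rtrancl)
  qed
  have "potential (insert e E) \<sigma> p" if eq: "\<sigma> {u, v} = p u * p v"
    unfolding e using p eq by (rule potential_insertI)
  moreover
  define q where "q = (\<lambda>x. if x \<in> C then - p x else p x)"
  have "potential (insert e E) \<sigma> q" if neq: "\<sigma> {u, v} \<noteq> p u * p v"
  proof -
    have "v \<notin> C"
      using balanced_chord_sign[of u v E \<sigma> p] insert.prems insert.hyps p e sig neq
      by (auto simp: C_def)
    moreover have "u \<in> C" by (simp add: C_def)
    ultimately have "\<sigma> {u, v} = q u * q v"
      using neq sig pv[of u] pv[of v] e by (auto simp: q_def)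
    moreover have "\<sigma> {x, y} = q x * q y" if "{x, y} \<in> E" for x y
    proof -
      have "\<sigma> {x, y} = p x * p y"
        using p that by (simp add: potential_def)
      then show ?thesis
        using C[OF that] by (simp add: q_def)
    qed
    moreover have "q x \<in> {1, -1}" for x
      using pv[of x] by (auto simp: q_def)
    ultimately show ?thesis
      unfolding e by (intro potential_insertI) (simp_all add: potential_def)
  qed
  ultimately show ?case by blast
qed

section \<open>Pairing vertices of a tree\<close>

text \<open>Trees presented as successive attachments of leaves, so that rule induction strips off
  one leaf.\<close>

inductive grown_tree :: "'a set \<Rightarrow> 'a set set \<Rightarrow> bool" where
  single: "grown_tree {r} {}"
| leaf: "grown_tree V E \<Longrightarrow> u \<in> V \<Longrightarrow> v \<notin> V \<Longrightarrow> grown_tree (insert v V) (insert {u, v} E)"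

lemma grown_tree_finite: "grown_tree V E \<Longrightarrow> finite V \<and> finite E \<and> \<Union>E \<subseteq> V"
  by (induction rule: grown_tree.induct) auto

text \<open>A maximal vertex set carrying a grown tree is closed under adjacency, so by
  connectedness it is all of \<open>V\<close>.\<close>

lemma connected_graph_spanning_tree:
  assumes "connected_graph V E" "finite V" "\<Union>E \<subseteq> V"
  shows "\<exists>F\<subseteq>E. grown_tree V F"
proof -
  define \<W> where "\<W> = {W. W \<subseteq> V \<and> (\<exists>F\<subseteq>E. grown_tree W F)}"
  obtain r where "r \<in> V"
    using assms(1) by (auto simp: connected_graph_def)
  then have "{r} \<in> \<W>"
    using grown_tree.single[of r] by (auto simp: \<W>_def intro!: exI[of _ "{}"])
  moreover have "finite \<W>"
    using assms(2) by (auto simp: \<W>_def intro: finite_subset[of _ "Pow V"])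
  ultimately obtain W where W: "W \<in> \<W>" and max: "\<And>W'. W' \<in> \<W> \<Longrightarrow> W \<subseteq> W' \<Longrightarrow> W = W'"
    using finite_has_maximal[of \<W>] by blast
  then obtain F where F: "F \<subseteq> E" "grown_tree W F" and "W \<subseteq> V"
    by (auto simp: \<W>_def)
  obtain w where w: "w \<in> W"
    using F(2) by (cases rule: grown_tree.cases) auto
  have closed: "y \<in> W" if "x \<in> W" "{x, y} \<in> E" "y \<in> V" for x y
  proof (rule ccontr)
    assume "y \<notin> W"
    then have "grown_tree (insert y W) (insert {x, y} F)"
      using F that by (intro grown_tree.leaf)
    then have "insert y W \<in> \<W>"
      using \<open>W \<subseteq> V\<close> F(1) that by (auto simp: \<W>_def intro!: exI[of _ "insert {x, y} F"])
    then show False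
      using max[of "insert y W"] \<open>y \<notin> W\<close> by blast
  qed
  have "x \<in> W" if "x \<in> V" for x
  proof -
    have "(w, x) \<in> {(x, y). {x, y} \<in> E}\<^sup>*"
      using assms(1) \<open>W \<subseteq> V\<close> w that by (auto simp: connected_graph_def)
    then show ?thesis
    proof (induction rule: rtrancl_induct)
      case (step y z)
      then show ?case using closed[of y z] assms(3) by blast
    qed (rule w)
  qed
  then have "W = V"
    using \<open>W \<subseteq> V\<close> by blast
  then show ?thesis
    using F by blast
qed

text \<open>With \<open>S\<close> the neighbours of the apex and \<open>\<tau>\<close> the signs of
  the edges to them, the right-hand side counts the edges violating \<open>p\<close> once
  \<open>p\<close> is 1 at the apex. Vertices of \<open>S\<close> paired along edge-disjoint tree
  paths get opposite signs: either \<open>p\<close> changes along the path or one end violates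
  \<open>\<tau>\<close>. The pairing stays implicit in the induction, which needs \<open>S\<close>
  arbitrary.\<close>

lemma grown_tree_signing:
  assumes "grown_tree V E" "S \<subseteq> V"
  shows "\<exists>\<tau>. (\<forall>v. \<tau> v \<in> {1, -1 :: int}) \<and>
    (\<forall>p. card S div 2 \<le> card {e \<in> E. \<exists>x\<in>e. \<exists>y\<in>e. p x \<noteq> p y} + card {v \<in> S. p v \<noteq> \<tau> v})"
  using assms
proof (induction arbitrary: S rule: grown_tree.induct)
  case (single r)
  then have "card S \<le> 1"
    using card_mono[of "{r}" S] by simp
  then show ?case
    by (intro exI[of _ "\<lambda>_. 1"]) simp
next
  case (leaf V E u v)
  let ?cut = "\<lambda>E p. {e \<in> E. \<exists>x\<in>e. \<exists>y\<in>e. p x \<noteq> (p y :: int)}"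
  let ?bad = "\<lambda>S \<tau> p. {v \<in> S. p v \<noteq> (\<tau> v :: int)}"
  have fin: "finite V" "finite E" "finite S" and "{u, v} \<notin> E" "u \<noteq> v"
    using grown_tree_finite[OF leaf.hyps(1)] leaf.hyps leaf.prems
    by (auto intro: finite_subset)
  have cut: "card (?cut (insert {u, v} E) p) = card (?cut E p) + (if p u = p v then 0 else 1)"
    for p
  proof -
    have "?cut (insert {u, v} E) p = (if p u = p v then {} else {{u, v}}) \<union> ?cut E p"
      by auto
    then show ?thesis
      using fin \<open>{u, v} \<notin> E\<close> by simp
  qed
  \<comment> \<open>The leaf \<open>v\<close> is ignored, paired with its neighbour
    \<open>u\<close>, or replaced by \<open>u\<close> as a vertex still to be paired.\<close>
  consider "v \<notin> S" | "v \<in> S" "u \<in> S" | "v \<in> S" "u \<notin> S" by blast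
  then show ?case
  proof cases
    case 1
    then have "S \<subseteq> V" using leaf.prems by auto
    from leaf.IH[OF this] obtain \<tau> where \<tau>: "\<forall>v. \<tau> v \<in> {1, -1}"
      and le: "\<And>p. card S div 2 \<le> card (?cut E p) + card (?bad S \<tau> p)"
      by blast
    have "card S div 2 \<le> card (?cut (insert {u, v} E) p) + card (?bad S \<tau> p)" for p
      using le[of p] unfolding cut by simp
    with \<tau> show ?thesis by blast
  next
    case 2
    let ?S = "S - {u, v}"
    have "?S \<subseteq> V" using leaf.prems by auto
    from leaf.IH[OF this] obtain \<tau> where \<tau>: "\<forall>v. \<tau> v \<in> {1, -1}"
      and le: "\<And>p. card ?S div 2 \<le> card (?cut E p) + card (?bad ?S \<tau> p)"
      by blast
    let ?\<tau> = "\<tau>(u := 1, v := -1)"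
    have "card {u, v} = 2" using \<open>u \<noteq> v\<close> by simp
    moreover have "card {u, v} \<le> card S"
      using 2 fin by (intro card_mono) auto
    ultimately have card: "card S div 2 = card ?S div 2 + 1"
      using 2 fin by (simp add: card_Diff_subset)
    have "card S div 2 \<le> card (?cut (insert {u, v} E) p) + card (?bad S ?\<tau> p)" for p
    proof -
      have split: "?bad S ?\<tau> p = ?bad ?S \<tau> p \<union> ?bad {u, v} ?\<tau> p"
        using 2 \<open>u \<noteq> v\<close> by auto
      have bad: "card (?bad S ?\<tau> p) = card (?bad ?S \<tau> p) + card (?bad {u, v} ?\<tau> p)"
        unfolding split by (rule card_Un_disjoint) (use fin in auto)
      have "(if p u = p v then 0 else 1) + card (?bad {u, v} ?\<tau> p) > 0"
      proof (cases "p u = p v")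
        case True
        \<comment> \<open>The common value of \<open>p\<close> cannot match both prescribed signs: 1
          is wrong at \<open>v\<close>, anything else is wrong at \<open>u\<close>.\<close>
        have "(if p u = 1 then v else u) \<in> ?bad {u, v} ?\<tau> p"
          using True \<open>u \<noteq> v\<close> by simp
        then have "?bad {u, v} ?\<tau> p \<noteq> {}"
          by blast
        then show ?thesis
          by (simp add: card_gt_0_iff)
      qed simp
      then show ?thesis
        using le[of p] unfolding cut bad card by linarith
    qed
    moreover have "\<forall>x. ?\<tau> x \<in> {1, -1}" using \<tau> by simp
    ultimately show ?thesis by blast
  next
    case 3
    let ?S = "insert u (S - {v})"
    have "?S \<subseteq> V" using leaf.prems leaf.hyps by auto
    from leaf.IH[OF this] obtain \<tau> where \<tau>: "\<forall>v. \<tau> v \<in> {1, -1}"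
      and le: "\<And>p. card ?S div 2 \<le> card (?cut E p) + card (?bad ?S \<tau> p)"
      by blast
    \<comment> \<open>The leaf inherits the sign of its substitute. If \<open>p u = p v\<close>, the
      violations at \<open>u\<close> and \<open>v\<close> agree; otherwise the new cut edge makes up
      for one that is lost.\<close>
    let ?\<tau> = "\<tau>(v := \<tau> u)"
    have card: "card ?S = card S"
      using 3 fin \<open>u \<noteq> v\<close> by (metis Diff_iff card.remove card_insert_disjoint finite_Diff)
    have "card S div 2 \<le> card (?cut (insert {u, v} E) p) + card (?bad S ?\<tau> p)" for p
    proof -
      let ?R = "?bad (S - {v}) \<tau> p"
      have S: "?bad ?S \<tau> p = (if p u = \<tau> u then {} else {u}) \<union> ?R"
        "?bad S ?\<tau> p = (if p v = \<tau> u then {} else {v}) \<union> ?R"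
        using 3 by auto
      have "card (?bad ?S \<tau> p) = card ?R + (if p u = \<tau> u then 0 else 1)"
        "card (?bad S ?\<tau> p) = card ?R + (if p v = \<tau> u then 0 else 1)"
        unfolding S using 3 fin by simp_all
      then show ?thesis
        using le[of p] unfolding cut card by (auto split: if_splits)
    qed
    moreover have "\<forall>x. ?\<tau> x \<in> {1, -1}" using \<tau> by simp
    ultimately show ?thesis by blast
  qed
qed

section \<open>Apex trees\<close>

lemma frustration_index_le:
  assumes "finite E" "D \<subseteq> E" "balanced (E - D) \<sigma>"
  shows "frustration_index E \<sigma> \<le> card D"
  unfolding frustration_index_def
  using assms by (intro Min_le) auto

lemma frustration_index_attained:
  assumes "finite E"
  obtains D where "D \<subseteq> E" "balanced (E - D) \<sigma>" "frustration_index E \<sigma> = card D"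
proof -
  have "balanced (E - E) \<sigma>"
    by (rule potential_imp_balanced[of _ _ "\<lambda>_. 1"]) (simp add: potential_def)
  then have "{card D | D. D \<subseteq> E \<and> balanced (E - D) \<sigma>} \<noteq> {}"
    by blast
  then have "frustration_index E \<sigma> \<in> {card D | D. D \<subseteq> E \<and> balanced (E - D) \<sigma>}"
    unfolding frustration_index_def using assms by (intro Min_in) auto
  then show thesis using that by blast
qed

lemma max_frustration_index_eqI:
  assumes "\<And>\<sigma>. signature E \<sigma> \<Longrightarrow> frustration_index E \<sigma> \<le> k"
    and "signature E \<sigma>" "k \<le> frustration_index E \<sigma>"
  shows "max_frustration_index E = k"
  unfolding max_frustration_index_def
proof (rule Max_eqI)
  \<comment> \<open>Signatures are unconstrained outside \<open>E\<close>, so finiteness is taken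
    from the bound \<open>k\<close> on the values instead of from the number of signatures.\<close>
  show "finite {frustration_index E \<sigma> |\<sigma>. signature E \<sigma>}"
    using assms(1) by (auto intro: finite_subset[of _ "{..k}"])
  show "k \<in> {frustration_index E \<sigma> |\<sigma>. signature E \<sigma>}"
    using assms(1)[OF assms(2)] assms(2,3) by (auto intro: exI[of _ \<sigma>])
qed (use assms(1) in auto)

section \<open>Edges at the apex and the two bounds\<close>

lemma simple_graph_finite_edges: "simple_graph V E \<Longrightarrow> finite E"
  by (auto simp: simple_graph_def intro: finite_subset[of _ "Pow V"])

lemma inj_on_pair_with: "inj_on (\<lambda>v. {h, v}) A"
  by (auto simp: inj_on_def doubleton_eq_iff)

lemma edges_at_vertex:
  assumes "simple_graph V E"
  shows "{e \<in> E. h \<in> e} = (\<lambda>v. {h, v}) ` {v. {h, v} \<in> E}"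
proof -
  have "\<exists>v. e = {h, v}" if "e \<in> E" "h \<in> e" for e
    using assms that by (fastforce simp: simple_graph_def card_2_iff)
  then show ?thesis by auto
qed

lemma degree_eq_card_neighbours:
  "simple_graph V E \<Longrightarrow> degree E h = card {v. {h, v} \<in> E}"
  by (simp add: degree_def edges_at_vertex card_image[OF inj_on_pair_with])

text \<open>The acyclic rest is balanced, hence has a potential. Extending it by \<open>s\<close> at
  \<open>h\<close> leaves violations only at \<open>h\<close>, and the violations for the two values
  of \<open>s\<close> form disjoint classes; the smaller has at most half of the edges at
  \<open>h\<close>.\<close>

lemma frustration_index_le_half_degree:
  assumes G: "simple_graph V E" and T: "\<nexists>c. is_cycle (remove_vertex E h) c"
    and sig: "signature E \<sigma>"
  shows "frustration_index E \<sigma> \<le> degree E h div 2"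
proof -
  let ?S = "{v. {h, v} \<in> E}"
  have finE: "finite E" using G by (rule simple_graph_finite_edges)
  have finS: "finite ?S"
    using finE finite_imageD[OF _ inj_on_pair_with] by (metis (no_types, lifting)
      finite_subset image_subsetI mem_Collect_eq)
  have "balanced (remove_vertex E h) \<sigma>"
    using T by (simp add: balanced_def)
  moreover have "finite (remove_vertex E h)" "\<forall>e\<in>remove_vertex E h. card e = 2"
    "signature (remove_vertex E h) \<sigma>"
    using finE G sig by (auto simp: remove_vertex_def simple_graph_def signature_def)
  ultimately obtain p where p: "potential (remove_vertex E h) \<sigma> p"
    using balanced_imp_potential by blast
  have ne: "u \<noteq> v" if "{u, v} \<in> E" for u v
    using G that by (auto simp: simple_graph_def)
  have le: "frustration_index E \<sigma> \<le> card {v \<in> ?S. \<sigma> {h, v} \<noteq> s * p v}" if s: "s \<in> {1, -1}" for s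
  proof -
    let ?D = "(\<lambda>v. {h, v}) ` {v \<in> ?S. \<sigma> {h, v} \<noteq> s * p v}"
    have "potential (E - ?D) \<sigma> (p(h := s))"
      unfolding potential_def
    proof (intro conjI allI impI)
      fix u v assume uv: "{u, v} \<in> E - ?D"
      then have "u \<noteq> v" using ne by blast
      consider "u = h" | "v = h" | "u \<noteq> h" "v \<noteq> h" by blast
      then show "\<sigma> {u, v} = (p(h := s)) u * (p(h := s)) v"
      proof cases
        case 1
        with uv \<open>u \<noteq> v\<close> show ?thesis by auto
      next
        case 2
        with uv \<open>u \<noteq> v\<close> show ?thesis by (auto simp: insert_commute mult.commute)
      next
        case 3
        with uv p show ?thesis by (auto simp: potential_def remove_vertex_def)
      qed
    qed (use p s in \<open>auto simp: potential_def\<close>)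
    then have "frustration_index E \<sigma> \<le> card ?D"
      using finE by (intro frustration_index_le potential_imp_balanced) auto
    then show ?thesis
      by (simp add: card_image[OF inj_on_pair_with])
  qed
  let ?A = "\<lambda>s. {v \<in> ?S. \<sigma> {h, v} \<noteq> s * p v}"
  \<comment> \<open>A sign differing from both \<open>p v\<close> and \<open>- p v\<close> is
    impossible.\<close>
  have "?A 1 \<inter> ?A (-1) = {}"
    using sig p by (fastforce simp: signature_def potential_def)
  then have "card (?A 1) + card (?A (-1)) = card (?A 1 \<union> ?A (-1))"
    using finS by (intro card_Un_disjoint[symmetric]) auto
  also have "\<dots> \<le> card ?S"
    using finS by (intro card_mono) auto
  also have "\<dots> = degree E h"
    using G by (simp add: degree_eq_card_neighbours)
  finally show ?thesis
    using le[of 1] le[of "-1"] by simp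
qed

text \<open>Any deletion set leaving a balanced graph contains every edge violating the resulting
  potential, and \<open>grown_tree_signing\<close> bounds the number of these from below.\<close>

lemma half_degree_le_frustration_index:
  assumes G: "simple_graph V E"
    and T: "connected_graph (V - {h}) (remove_vertex E h)"
  shows "\<exists>\<sigma>. signature E \<sigma> \<and> degree E h div 2 \<le> frustration_index E \<sigma>"
proof -
  let ?S = "{v. {h, v} \<in> E}"
  have finE: "finite E" using G by (rule simple_graph_finite_edges)
  have finV: "finite V" and S: "?S \<subseteq> V - {h}"
    using G by (auto simp: simple_graph_def)
  obtain F where F: "F \<subseteq> remove_vertex E h" "grown_tree (V - {h}) F"
    using connected_graph_spanning_tree[OF T] finV G
    by (auto simp: simple_graph_def remove_vertex_def)
  obtain \<tau> :: "'a \<Rightarrow> int" where \<tau>: "\<And>v. \<tau> v \<in> {1, -1}" and le: "\<And>p. card ?S div 2 \<le>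
    card {e \<in> F. \<exists>x\<in>e. \<exists>y\<in>e. p x \<noteq> p y} + card {v \<in> ?S. p v \<noteq> \<tau> v}"
    using grown_tree_signing[OF F(2) S] by blast
  \<comment> \<open>Positive away from \<open>h\<close>, and \<open>\<tau> v\<close> on the edge
    from \<open>h\<close> to \<open>v\<close>; the description recovers \<open>v\<close> from the
    edge.\<close>
  define \<sigma> where "\<sigma> e = (if h \<in> e then \<tau> (THE v. e = {h, v}) else 1)" for e
  have \<sigma>h: "\<sigma> {h, v} = \<tau> v" for v
  proof -
    have "(THE w. {h, v} = {h, w}) = v"
      by (rule the_equality) (auto simp: doubleton_eq_iff)
    then show ?thesis by (simp add: \<sigma>_def)
  qed
  have sig: "signature E \<sigma>"
    using \<tau> by (simp add: signature_def \<sigma>_def)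
  obtain D where D: "D \<subseteq> E" "balanced (E - D) \<sigma>" "frustration_index E \<sigma> = card D"
    using frustration_index_attained[OF finE] .
  have "finite (E - D)" "\<forall>e\<in>E - D. card e = 2" "signature (E - D) \<sigma>"
    using finE G sig by (auto simp: simple_graph_def signature_def)
  then obtain p where p: "potential (E - D) \<sigma> p"
    using balanced_imp_potential D(2) by blast
  then have pv: "p x \<in> {1, -1}" for x
    by (simp add: potential_def)
  \<comment> \<open>Normalised to be 1 at \<open>h\<close>, so that an edge from \<open>h\<close> to
    \<open>v\<close> respects \<open>p\<close> exactly when \<open>q v = \<tau> v\<close>.\<close>
  define q where "q v = p h * p v" for v
  let ?cut = "{e \<in> F. \<exists>x\<in>e. \<exists>y\<in>e. q x \<noteq> q y}" and ?bad = "{v \<in> ?S. q v \<noteq> \<tau> v}"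
  \<comment> \<open>A cut edge is positive while its ends have different potentials, so it must have
    been deleted.\<close>
  have "?cut \<subseteq> D"
  proof
    fix e assume e: "e \<in> ?cut"
    then obtain x y where xy: "x \<in> e" "y \<in> e" "q x \<noteq> q y" by blast
    have "e \<in> E" "h \<notin> e" using e F(1) by (auto simp: remove_vertex_def)
    moreover from this have "e = {x, y}"
      using G xy by (fastforce simp: simple_graph_def card_2_iff)
    moreover have "p x * p y \<noteq> 1"
      using xy pv[of x] pv[of y] by (auto simp: q_def)
    moreover have "\<sigma> e = 1"
      using \<open>h \<notin> e\<close> by (simp add: \<sigma>_def)
    ultimately show "e \<in> D"
      using p by (auto simp: potential_def)
  qed
  moreover have "(\<lambda>v. {h, v}) ` ?bad \<subseteq> D"
    using p \<sigma>h by (fastforce simp: potential_def q_def)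
  moreover have "?cut \<inter> (\<lambda>v. {h, v}) ` ?bad = {}"
    using F(1) by (auto simp: remove_vertex_def)
  moreover have "finite D" using D(1) finE finite_subset by blast
  ultimately have "card ?cut + card ((\<lambda>v. {h, v}) ` ?bad) \<le> card D"
    by (metis (no_types, lifting) card_Un_disjoint card_mono finite_subset Un_least)
  then have "degree E h div 2 \<le> frustration_index E \<sigma>"
    using le[of q] D(3) G
    by (simp add: card_image[OF inj_on_pair_with] degree_eq_card_neighbours)
  with sig show ?thesis by blast
qed

theorem theorem10:
  fixes V :: "'a set" and E :: "'a set set" and h :: 'a and n :: nat
  assumes "apex_tree V E h n"
  shows "max_frustration_index E = n div 2"
proof -
  have G: "simple_graph V E" and n: "degree E h = n"
    and conn: "connected_graph (V - {h}) (remove_vertex E h)"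
    and acyc: "\<nexists>c. is_cycle (remove_vertex E h) c"
    using assms by (auto simp: apex_tree_def is_tree_def)
  obtain \<sigma> where "signature E \<sigma>" "n div 2 \<le> frustration_index E \<sigma>"
    using half_degree_le_frustration_index[OF G conn] n by blast
  moreover have "frustration_index E \<sigma> \<le> n div 2" if "signature E \<sigma>" for \<sigma>
    using frustration_index_le_half_degree[OF G acyc that] n by simp
  ultimately show ?thesis
    by (intro max_frustration_index_eqI)
qed

end
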